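(* Let $p\in(0,1)$ and $\varepsilon>0$. There is a constant $C_\varepsilon>0$ such that the following holds. Let $m,n$ be sufficiently large positive integers with $n<m$, and let $b=n/m$. A random linear rank metric code $\mathcal{C}\subseteq\mathbb{F}_2^{m\times n}$ of rate $R=(1-p)(1-bp)-\varepsilon$ is $\left(p,\frac{p+bp-bp^2}{\varepsilon}+2\right)$-list decodable with probability at least $1-\exp(-C_\varepsilon mn)$.
   Context: For $X,Y\in\mathbb{F}_q^{m\times n}$, the rank ball is $\mathcal{B}_R(X,pn)=\{Y\in\mathbb{F}_q^{m\times n}:\mathrm{rank}(X-Y)\le pn\}$. A rank metric code $\mathcal{C}\subseteq\mathbb{F}_q^{m\times n}$ is $(p,L)$-list decodable if $|\mathcal{B}_R(X,pn)\cap\mathcal{C}|\le L$ for all $X\in\mathbb{F}_q^{m\times n}$; its rate is $\log_q|\mathcal{C}|/(mn)$. A random linear rank metric code of rate $R$ over $\mathbb{F}_2$ is $\mathrm{span}_{\mathbb{F}_2}(Y_1,\dots,Y_k)$ with $k=Rmn$ (assumed an integer) and $Y_1,\dots,Y_k$ independent uniformly random matrices in $\mathbb{F}_2^{m\times n}$. *)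

theory Defs
  imports "HOL-Library.Z2" "Jordan_Normal_Form.DL_Rank"
begin

definition rank2 :: "nat \<Rightarrow> bit mat \<Rightarrow> nat" where
  "rank2 m A = vec_space.rank m A"  \<comment> \<open>rank of a matrix with m rows (column rank)\<close>

definition rank_ball :: "nat \<Rightarrow> nat \<Rightarrow> bit mat \<Rightarrow> real \<Rightarrow> bit mat set" where
  "rank_ball m n X r = {Y \<in> carrier_mat m n. real (rank2 m (X - Y)) \<le> r}"

definition list_decodable :: "nat \<Rightarrow> nat \<Rightarrow> bit mat set \<Rightarrow> real \<Rightarrow> real \<Rightarrow> bool" where
  "list_decodable m n C p L \<longleftrightarrow>
     (\<forall>X \<in> carrier_mat m n. real (card (rank_ball m n X (p * real n) \<inter> C)) \<le> L)"

fun lsum :: "nat \<Rightarrow> nat \<Rightarrow> bit mat list \<Rightarrow> bit mat" where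
  "lsum m n [] = 0\<^sub>m m n"
| "lsum m n (A # As) = A + lsum m n As"

definition span2 :: "nat \<Rightarrow> nat \<Rightarrow> bit mat list \<Rightarrow> bit mat set" where
  "span2 m n Ys = {lsum m n (map2 (\<lambda>c A. c \<cdot>\<^sub>m A) cs Ys) | cs. length cs = length Ys}"

definition prob_rand_code_ld :: "nat \<Rightarrow> nat \<Rightarrow> nat \<Rightarrow> real \<Rightarrow> real \<Rightarrow> real" where
  "prob_rand_code_ld m n k p L =
     real (card {Ys. length Ys = k \<and> set Ys \<subseteq> carrier_mat m n \<and> list_decodable m n (span2 m n Ys) p L})
     / real (card {Ys :: bit mat list. length Ys = k \<and> set Ys \<subseteq> carrier_mat m n})"

end

theory Submission
  imports Defs
begin

text \<open>
  Write \<open>M = m n\<close>, \<open>h = p + b p - b p\<^sup>2\<close>, and let \<open>L\<^sub>C(X)\<close> be the number of codewords in the rank ball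
  around \<open>X\<close>. Following Guruswami, Hastad, Sudan and Zuckerman and Li and Wootters, consider the
  potential \<open>W(C) = (\<Sum>X. a ^ L\<^sub>C(X) - 1)\<close> with \<open>a = 2 powr ((\<epsilon> - \<delta>) M)\<close>. Adjoining a random matrix \<open>Y\<close> to
  \<open>C\<close> gives at most \<open>2 W(C) + Q(Y)\<close>, where \<open>Q \<ge> 0\<close> sums to \<open>W(C)\<^sup>2\<close> over all \<open>Y\<close>. By Markov's
  inequality \<open>W\<close> therefore grows by a factor of at most \<open>2 + \<eta>\<close> per step, except with exponentially small
  probability, as long as it is exponentially smaller than \<open>2 ^ M\<close>. Initially \<open>W\<close> is about
  \<open>a 2 powr (h M)\<close> because there are about \<open>2 powr (h M)\<close> matrices of rank at most \<open>p n\<close>, and the rate is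
  \<open>1 - h - \<epsilon>\<close>, so \<open>W\<close> ends up below \<open>2 powr ((1 - \<delta> / 2) M)\<close>. Finally \<open>L\<^sub>C\<close> is constant on the cosets of
  \<open>C\<close>, so the coset of any \<open>X\<close> contributes \<open>2 ^ k (a ^ L\<^sub>C(X) - 1)\<close> to \<open>W\<close>, which bounds \<open>L\<^sub>C(X)\<close> by
  \<open>(h + \<epsilon>) / (\<epsilon> - \<delta>)\<close>.
\<close>

subsection \<open>Finite elementary abelian 2-groups\<close>

text \<open>Used twice: for column vectors, to count matrices by rank, and for matrices, where the
  code lives. Over the field with two elements a linear span is just a generated subgroup, so
  scalars disappear.\<close>

locale elementary_two_group =
  fixes G :: "'a set" and add :: "'a \<Rightarrow> 'a \<Rightarrow> 'a" (infixl "\<boxplus>" 65) and e :: 'a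
  assumes finite_carrier: "finite G"
    and add_closed [simp]: "x \<in> G \<Longrightarrow> y \<in> G \<Longrightarrow> x \<boxplus> y \<in> G"
    and zero_closed [simp]: "e \<in> G"
    and add_assoc: "x \<in> G \<Longrightarrow> y \<in> G \<Longrightarrow> z \<in> G \<Longrightarrow> x \<boxplus> y \<boxplus> z = x \<boxplus> (y \<boxplus> z)"
    and add_comm: "x \<in> G \<Longrightarrow> y \<in> G \<Longrightarrow> x \<boxplus> y = y \<boxplus> x"
    and zero_add [simp]: "x \<in> G \<Longrightarrow> e \<boxplus> x = x"
    and add_self [simp]: "x \<in> G \<Longrightarrow> x \<boxplus> x = e"
begin

lemma add_zero [simp]: "x \<in> G \<Longrightarrow> x \<boxplus> e = x"
  by (simp add: add_comm)

lemma add_add_cancel [simp]: "x \<in> G \<Longrightarrow> y \<in> G \<Longrightarrow> x \<boxplus> (x \<boxplus> y) = y"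
  by (simp flip: add_assoc)

lemma add_left_comm: "x \<in> G \<Longrightarrow> y \<in> G \<Longrightarrow> z \<in> G \<Longrightarrow> x \<boxplus> (y \<boxplus> z) = y \<boxplus> (x \<boxplus> z)"
  by (metis add_assoc add_comm)

lemma inj_on_translate: "b \<in> G \<Longrightarrow> inj_on ((\<boxplus>) b) G"
  by (rule inj_on_inverseI [where g = "(\<boxplus>) b"]) simp

lemma bij_betw_translate: "b \<in> G \<Longrightarrow> bij_betw ((\<boxplus>) b) G G"
  by (rule bij_betw_byWitness [where f' = "(\<boxplus>) b"]) auto

lemma sum_translate: "b \<in> G \<Longrightarrow> (\<Sum>x\<in>G. f (b \<boxplus> x)) = sum f G"
  by (rule sum.reindex_bij_betw [OF bij_betw_translate])

section \<open>Subgroups and spans of lists\<close>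

definition subgp :: "'a set \<Rightarrow> bool" where
  "subgp C \<longleftrightarrow> C \<subseteq> G \<and> e \<in> C \<and> (\<forall>x\<in>C. \<forall>y\<in>C. x \<boxplus> y \<in> C)"

lemma subgp_finite: "subgp C \<Longrightarrow> finite C"
  using finite_carrier finite_subset subgp_def by blast

lemma subgp_extend:
  assumes "subgp C" "b \<in> G"
  shows "subgp (C \<union> (\<boxplus>) b ` C)"
proof -
  have "x \<boxplus> y \<in> C" if "x \<in> C" "y \<in> C" for x y
    using that assms by (auto simp: subgp_def)
  moreover have "x \<in> G" if "x \<in> C" for x
    using that assms by (auto simp: subgp_def)
  moreover have "x \<boxplus> (b \<boxplus> y) = b \<boxplus> (x \<boxplus> y)" "(b \<boxplus> x) \<boxplus> (b \<boxplus> y) = x \<boxplus> y"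
    "(b \<boxplus> x) \<boxplus> y = b \<boxplus> (x \<boxplus> y)"
    if "x \<in> G" "y \<in> G" for x y
    using that assms(2) by (simp_all add: add_left_comm add_assoc)
  ultimately show ?thesis
    using assms unfolding subgp_def by (auto 4 3)
qed

fun gspan :: "'a list \<Rightarrow> 'a set" where
  "gspan [] = {e}"
| "gspan (v # vs) = gspan vs \<union> (\<boxplus>) v ` gspan vs"

lemma subgp_gspan: "set vs \<subseteq> G \<Longrightarrow> subgp (gspan vs)"
proof (induction vs)
  case Nil
  then show ?case by (simp add: subgp_def)
next
  case (Cons v vs)
  then show ?case using subgp_extend [of "gspan vs" v] by simp
qed

lemma gspan_Cons_in:
  assumes "set vs \<subseteq> G" "v \<in> gspan vs"
  shows "gspan (v # vs) = gspan vs"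
  using subgp_gspan [OF assms(1)] assms(2) by (auto simp: subgp_def)

text \<open>The translate of the span by \<open>v\<close> is disjoint from it: if \<open>c\<close>
  and \<open>v \<boxplus> c\<close> both lie in the span, so does their sum
  \<open>v\<close>.\<close>

lemma card_gspan_Cons_notin:
  assumes "set vs \<subseteq> G" "v \<in> G" "v \<notin> gspan vs"
  shows "card (gspan (v # vs)) = 2 * card (gspan vs)"
proof -
  let ?C = "gspan vs"
  have C: "subgp ?C" using subgp_gspan assms(1) by blast
  then have sub: "?C \<subseteq> G" by (simp add: subgp_def)
  have "?C \<inter> (\<boxplus>) v ` ?C = {}"
  proof (rule ccontr)
    assume "?C \<inter> (\<boxplus>) v ` ?C \<noteq> {}"
    then obtain c where c: "c \<in> ?C" "v \<boxplus> c \<in> ?C" by auto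
    then have "c \<boxplus> (v \<boxplus> c) \<in> ?C" using C by (simp add: subgp_def)
    moreover have "c \<boxplus> (v \<boxplus> c) = v"
      using c(1) sub assms(2) by (metis add_add_cancel add_comm subsetD)
    ultimately show False using assms(3) by simp
  qed
  moreover have "card ((\<boxplus>) v ` ?C) = card ?C"
    using inj_on_translate [OF assms(2)] sub by (meson card_image inj_on_subset)
  ultimately show ?thesis
    using subgp_finite [OF C] by (simp add: card_Un_disjoint)
qed

lemma card_gspan_le: "set vs \<subseteq> G \<Longrightarrow> card (gspan vs) \<le> 2 ^ length vs"
proof (induction vs)
  case (Cons v vs)
  then show ?case
    using gspan_Cons_in [of vs v] card_gspan_Cons_notin [of vs v] by (cases "v \<in> gspan vs") auto
qed simp

lemma card_gspan_power: "set vs \<subseteq> G \<Longrightarrow> \<exists>j\<le>length vs. card (gspan vs) = 2 ^ j"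
proof (induction vs)
  case (Cons v vs)
  then obtain j where j: "j \<le> length vs" "card (gspan vs) = 2 ^ j" by auto
  show ?case
  proof (cases "v \<in> gspan vs")
    case True
    then show ?thesis using Cons.prems gspan_Cons_in [of vs v] j by (auto intro: exI [of _ j])
  next
    case False
    then show ?thesis
      using Cons.prems card_gspan_Cons_notin [of vs v] j by (intro exI [of _ "Suc j"]) auto
  qed
qed simp

section \<open>Counting lists by the size of their span\<close>

definition rank_lists :: "nat \<Rightarrow> nat \<Rightarrow> 'a list set" where
  "rank_lists n j = {vs. length vs = n \<and> set vs \<subseteq> G \<and> card (gspan vs) = 2 ^ j}"

lemma finite_lists_in: "finite {vs. length vs = n \<and> set vs \<subseteq> G}"
  using finite_lists_length_eq [OF finite_carrier, of n] by (simp add: conj_commute)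

lemma finite_rank_lists: "finite (rank_lists n j)"
  by (rule finite_subset [OF _ finite_lists_in [of n]]) (auto simp: rank_lists_def)

lemma rank_lists_empty: "n < j \<Longrightarrow> rank_lists n j = {}"
  using card_gspan_le by (fastforce simp: rank_lists_def)

text \<open>A new head either lies in the span of the tail, which leaves \<open>2 ^ j\<close> choices, or doubles
  that span.\<close>

lemma card_rank_lists_Suc:
  "card (rank_lists (Suc n) j)
     \<le> card (rank_lists n j) * 2 ^ j + (if j = 0 then 0 else card (rank_lists n (j - 1)) * card G)"
proof -
  define S1 where "S1 = (SIGMA vs : rank_lists n j. gspan vs)"
  define S2 where "S2 = (if j = 0 then {} else rank_lists n (j - 1) \<times> G)"
  have fin: "finite S1" "finite S2"
    using finite_rank_lists finite_carrier subgp_finite subgp_gspan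
    by (auto simp: S1_def S2_def rank_lists_def intro!: finite_SigmaI)
  have "rank_lists (Suc n) j \<subseteq> (\<lambda>(vs, v). v # vs) ` (S1 \<union> S2)"
  proof
    fix ws assume ws: "ws \<in> rank_lists (Suc n) j"
    then obtain v vs where wv: "ws = v # vs" by (cases ws) (auto simp: rank_lists_def)
    have *: "length vs = n" "v \<in> G" "set vs \<subseteq> G" "card (gspan (v # vs)) = 2 ^ j"
      using ws unfolding wv rank_lists_def by auto
    have "(vs, v) \<in> S1 \<union> S2"
    proof (cases "v \<in> gspan vs")
      case True
      then show ?thesis using * gspan_Cons_in [of vs v] by (simp add: S1_def rank_lists_def)
    next
      case False
      then have "2 * card (gspan vs) = 2 ^ j" using * card_gspan_Cons_notin by metis
      then show ?thesis using * by (cases j) (auto simp: S2_def rank_lists_def)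
    qed
    then show "ws \<in> (\<lambda>(vs, v). v # vs) ` (S1 \<union> S2)" using wv by force
  qed
  then have "card (rank_lists (Suc n) j) \<le> card (S1 \<union> S2)"
    using fin by (meson card_image_le card_mono finite_Un finite_imageI order_trans)
  also have "\<dots> \<le> card S1 + card S2" by (rule card_Un_le)
  also have "card S1 = card (rank_lists n j) * 2 ^ j"
  proof -
    have "card S1 = (\<Sum>vs\<in>rank_lists n j. card (gspan vs))"
      unfolding S1_def by (rule card_SigmaI)
        (use finite_rank_lists subgp_finite subgp_gspan in \<open>auto simp: rank_lists_def\<close>)
    then show ?thesis by (simp add: rank_lists_def)
  qed
  finally show ?thesis by (auto simp: S2_def card_cartesian_product split: if_splits)
qed

text \<open>Read as columns, the lists are matrices of rank \<open>j\<close>, and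
  \<open>j * (m + n - j)\<close> is the dimension of the variety of such matrices. Each of the two
  terms of the recursion obeys the bound without an extra factor; adding them costs a factor 2 per
  column, whence \<open>2 ^ n\<close>.\<close>

lemma card_rank_lists:
  assumes "card G = 2 ^ m" "j \<le> n"
  shows "card (rank_lists n j) \<le> 2 ^ n * 2 ^ (j * (m + n - j))"
  using assms(2)
proof (induction n arbitrary: j)
  case 0
  have "rank_lists 0 0 \<subseteq> {[]}" by (auto simp: rank_lists_def)
  then have "card (rank_lists 0 0) \<le> card {[] :: 'a list}" by (intro card_mono) auto
  then show ?case using 0 by simp
next
  case (Suc n)
  have a: "card (rank_lists n j) * 2 ^ j \<le> 2 ^ n * 2 ^ (j * (m + Suc n - j))"
  proof (cases "j \<le> n")
    case True
    have "card (rank_lists n j) * 2 ^ j \<le> 2 ^ n * 2 ^ (j * (m + n - j)) * 2 ^ j"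
      using Suc.IH [OF True] by simp
    also have "\<dots> = 2 ^ n * 2 ^ (j * (m + n - j) + j)" by (simp add: power_add)
    also have "j * (m + n - j) + j = j * (m + Suc n - j)"
    proof -
      obtain d where d: "n = j + d" using True le_Suc_ex by blast
      have "m + n - j = m + d" "m + Suc n - j = Suc (m + d)" using d by simp_all
      then show ?thesis by simp
    qed
    finally show ?thesis .
  qed (simp add: rank_lists_empty)
  have b: "card (rank_lists n (j - 1)) * card G \<le> 2 ^ n * 2 ^ (j * (m + Suc n - j))" if j0: "j \<noteq> 0"
  proof -
    obtain i where i: "j = Suc i" using not0_implies_Suc [OF j0] by blast
    then have "i \<le> n" using Suc.prems by simp
    then obtain d where d: "n = i + d" using le_Suc_ex by blast
    have "card (rank_lists n (j - 1)) * card G \<le> 2 ^ n * 2 ^ (i * (m + n - i)) * 2 ^ m"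
      using Suc.IH [OF \<open>i \<le> n\<close>] assms(1) i by simp
    also have "\<dots> = 2 ^ n * 2 ^ (i * (m + n - i) + m)" by (simp add: power_add)
    also have "\<dots> \<le> 2 ^ n * 2 ^ (j * (m + Suc n - j))"
    proof -
      have "m + n - i = m + d" "m + Suc n - j = m + d" using d i by simp_all
      then show ?thesis using i by (intro mult_left_mono power_increasing) auto
    qed
    finally show ?thesis .
  qed
  show ?case
    using card_rank_lists_Suc [of n j] a b by (cases "j = 0") auto
qed

subsection \<open>The potential of a random span\<close>

text \<open>For \<open>B\<close> the ball around zero this is the list size at \<open>x\<close>,
  since sums are differences here.\<close>

definition hits :: "'a set \<Rightarrow> 'a set \<Rightarrow> 'a \<Rightarrow> nat" where
  "hits B C x = card {y \<in> C. x \<boxplus> y \<in> B}"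

text \<open>Subtracting 1 makes centres with an empty list contribute nothing, so the starting value
  is proportional to \<open>card B\<close>.\<close>

definition potential :: "real \<Rightarrow> 'a set \<Rightarrow> 'a set \<Rightarrow> real" where
  "potential a B C = (\<Sum>x\<in>G. a ^ hits B C x - 1)"

lemma potential_zero:
  fixes a :: real
  assumes "B \<subseteq> G"
  shows "potential a B {e} = (a - 1) * card B"
proof -
  have "a ^ hits B {e} x - 1 = (if x \<in> B then a - 1 else 0)" if "x \<in> G" for x
  proof -
    have "{y \<in> {e}. x \<boxplus> y \<in> B} = (if x \<in> B then {e} else {})" using that by auto
    then show ?thesis by (simp add: hits_def)
  qed
  then have "potential a B {e} = (\<Sum>x\<in>G. if x \<in> B then a - 1 else 0)"
    unfolding potential_def by (intro sum.cong) auto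
  also have "\<dots> = (\<Sum>x\<in>B. a - 1)"
    using assms finite_carrier by (simp add: sum.If_cases Int_absorb1)
  finally show ?thesis by simp
qed

lemma hits_translate:
  assumes "subgp C" "c \<in> C" "x \<in> G"
  shows "hits B C (c \<boxplus> x) = hits B C x"
proof -
  have C: "C \<subseteq> G" "\<And>y. y \<in> C \<Longrightarrow> c \<boxplus> y \<in> C" "c \<in> G"
    using assms by (auto simp: subgp_def)
  have "bij_betw ((\<boxplus>) c) {y \<in> C. (c \<boxplus> x) \<boxplus> y \<in> B} {y \<in> C. x \<boxplus> y \<in> B}"
    using C assms(3)
    by (intro bij_betw_byWitness [where f' = "(\<boxplus>) c"])
      (auto simp: subset_iff add_assoc add_left_comm [of c x])
  then show ?thesis unfolding hits_def by (rule bij_betw_same_card)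
qed

text \<open>A large value of \<open>hits\<close> is shared by a whole coset of \<open>C\<close>; this is what improves the list
  size from \<open>1/\<epsilon>\<close> to the stated bound.\<close>

lemma card_mult_hits_le_potential:
  fixes a :: real
  assumes "subgp C" "x \<in> G" "1 \<le> a"
  shows "card C * (a ^ hits B C x - 1) \<le> potential a B C"
proof -
  have C: "C \<subseteq> G" using assms by (simp add: subgp_def)
  have sub: "(\<lambda>c. c \<boxplus> x) ` C \<subseteq> G" using C assms(2) by auto
  have inj: "inj_on (\<lambda>c. c \<boxplus> x) C"
    using C assms(2) by (intro inj_onI) (metis add_add_cancel add_comm subsetD)
  have "card C * (a ^ hits B C x - 1) = (\<Sum>c\<in>C. a ^ hits B C (c \<boxplus> x) - 1)"
    using hits_translate [OF assms(1) _ assms(2)] by simp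
  also have "\<dots> = (\<Sum>y\<in>(\<lambda>c. c \<boxplus> x) ` C. a ^ hits B C y - 1)"
    using inj by (simp add: sum.reindex)
  also have "\<dots> \<le> potential a B C"
    unfolding potential_def using finite_carrier sub assms(3)
    by (intro sum_mono2) auto
  finally show ?thesis .
qed

text \<open>The autocorrelation at shift \<open>b\<close> of the summand of
  \<open>potential\<close>; it plays the role of the error term \<open>Q\<close>.\<close>

definition corr :: "real \<Rightarrow> 'a set \<Rightarrow> 'a set \<Rightarrow> 'a \<Rightarrow> real" where
  "corr a B C b = (\<Sum>x\<in>G. (a ^ hits B C x - 1) * (a ^ hits B C (b \<boxplus> x) - 1))"

lemma corr_nonneg: "1 \<le> a \<Longrightarrow> 0 \<le> corr a B C b"
  unfolding corr_def by (intro sum_nonneg) simp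

text \<open>After exchanging the sums, \<open>b \<boxplus> x\<close> runs through all of
  \<open>G\<close> for each fixed \<open>x\<close>, so the two factors separate.\<close>

lemma sum_corr: "(\<Sum>b\<in>G. corr a B C b) = (potential a B C)\<^sup>2"
proof -
  let ?f = "\<lambda>x. a ^ hits B C x - 1"
  have "(\<Sum>b\<in>G. corr a B C b) = (\<Sum>x\<in>G. ?f x * (\<Sum>b\<in>G. ?f (b \<boxplus> x)))"
    unfolding corr_def by (subst sum.swap) (simp add: sum_distrib_left)
  also have "\<dots> = (\<Sum>x\<in>G. ?f x * (\<Sum>b\<in>G. ?f (x \<boxplus> b)))"
    by (intro sum.cong refl arg_cong2 [where f = "(*)"]) (simp add: add_comm)
  also have "\<dots> = (\<Sum>x\<in>G. ?f x * potential a B C)"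
    using sum_translate [where f = ?f] by (simp add: potential_def)
  finally show ?thesis
    by (simp add: potential_def power2_eq_square sum_distrib_right)
qed

text \<open>The new list at \<open>x\<close> is covered by the old list at \<open>x\<close> and a
  translate of the old list at \<open>b \<boxplus> x\<close>; these coincide if \<open>b\<close> is
  in \<open>C\<close>, hence only an inequality. Then
  \<open>(1 + f) * (1 + g) - 1 = f + g + f * g\<close>, and the products sum to
  \<open>corr\<close>.\<close>

lemma potential_extend:
  assumes "subgp C" "b \<in> G" "1 \<le> a"
  shows "potential a B (C \<union> (\<boxplus>) b ` C) \<le> 2 * potential a B C + corr a B C b"
proof -
  let ?f = "\<lambda>x. a ^ hits B C x - 1"
  have C: "C \<subseteq> G" "finite C" using assms subgp_finite by (auto simp: subgp_def)
  have "hits B (C \<union> (\<boxplus>) b ` C) x \<le> hits B C x + hits B C (b \<boxplus> x)" if x: "x \<in> G" for x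
  proof -
    have "x \<boxplus> (b \<boxplus> y) = b \<boxplus> x \<boxplus> y" if "y \<in> C" for y
      using that C(1) x assms(2) by (metis add_assoc add_comm subsetD)
    then have "{y \<in> C \<union> (\<boxplus>) b ` C. x \<boxplus> y \<in> B}
        \<subseteq> {y \<in> C. x \<boxplus> y \<in> B} \<union> (\<boxplus>) b ` {y \<in> C. b \<boxplus> x \<boxplus> y \<in> B}"
      by auto
    then have "hits B (C \<union> (\<boxplus>) b ` C) x
        \<le> card ({y \<in> C. x \<boxplus> y \<in> B} \<union> (\<boxplus>) b ` {y \<in> C. b \<boxplus> x \<boxplus> y \<in> B})"
      unfolding hits_def using C(2) by (intro card_mono) auto
    also have "\<dots> \<le> hits B C x + hits B C (b \<boxplus> x)"
      unfolding hits_def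
      by (rule order_trans [OF card_Un_le]) (use C(2) in \<open>simp add: card_image_le\<close>)
    finally show ?thesis .
  qed
  then have "a ^ hits B (C \<union> (\<boxplus>) b ` C) x \<le> a ^ (hits B C x + hits B C (b \<boxplus> x))"
    if "x \<in> G" for x
    using that assms(3) by (simp add: power_increasing)
  then have "potential a B (C \<union> (\<boxplus>) b ` C) \<le> (\<Sum>x\<in>G. a ^ (hits B C x + hits B C (b \<boxplus> x)) - 1)"
    unfolding potential_def by (intro sum_mono) auto
  also have "\<dots> = (\<Sum>x\<in>G. ?f x + ?f (b \<boxplus> x) + ?f x * ?f (b \<boxplus> x))"
    by (simp add: power_add algebra_simps)
  also have "\<dots> = 2 * potential a B C + corr a B C b"
    using sum_translate [OF assms(2), where f = ?f]
    by (simp only: sum.distrib corr_def potential_def)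
  finally show ?thesis .
qed

lemma potential_nonneg: "1 \<le> a \<Longrightarrow> 0 \<le> potential a B C"
  unfolding potential_def by (intro sum_nonneg) simp

text \<open>Markov's inequality in counting form: nonnegative correlations with total at most
  \<open>w\<^sup>2\<close>.\<close>

lemma card_large_corr:
  assumes "1 \<le> a" "potential a B C \<le> w" "0 < w" "0 < \<eta>"
  shows "card {b \<in> G. corr a B C b > \<eta> * w} \<le> w / \<eta>"
proof -
  let ?S = "{b \<in> G. corr a B C b > \<eta> * w}"
  have "card ?S * (\<eta> * w) \<le> (\<Sum>b\<in>?S. corr a B C b)"
    using sum_mono [of ?S "\<lambda>_. \<eta> * w" "corr a B C"] by simp
  also have "\<dots> \<le> (\<Sum>b\<in>G. corr a B C b)"
    using finite_carrier corr_nonneg [OF assms(1)] by (intro sum_mono2) auto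
  also have "\<dots> \<le> w\<^sup>2"
    unfolding sum_corr using assms potential_nonneg by (intro power_mono) auto
  finally show ?thesis
    using assms(3,4) by (simp add: field_simps power2_eq_square)
qed

text \<open>The size condition expresses independence of the generators. It is carried along because
  the final coset argument gains a factor equal to the size of the code.\<close>

definition good :: "real \<Rightarrow> 'a set \<Rightarrow> real \<Rightarrow> 'a list \<Rightarrow> bool" where
  "good a B w vs \<longleftrightarrow> card (gspan vs) = 2 ^ length vs \<and> potential a B (gspan vs) \<le> w"

text \<open>A list is bad only if its tail is bad or its head is one of few exceptional elements.
  The factor \<open>card G\<close> on the left states the bound on the failure probability without a
  division.\<close>

lemma card_not_good:
  fixes a w \<eta> :: real
  assumes "1 \<le> a" "0 < \<eta>" "0 < w" "(a - 1) * card B \<le> w" "B \<subseteq> G"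
  shows "card G * card {vs. length vs = k \<and> set vs \<subseteq> G \<and> \<not> good a B (w * (2 + \<eta>) ^ k) vs}
           \<le> card G ^ k * (w * (2 + \<eta>) ^ k / \<eta> + 2 ^ k)"
proof (induction k)
  case 0
  have "good a B w []"
    using assms(4,5) by (simp add: good_def potential_zero)
  then have *: "{vs. length vs = 0 \<and> set vs \<subseteq> G \<and> \<not> good a B (w * (2 + \<eta>) ^ 0) vs} = {}"
    by auto
  show ?case unfolding * using assms(2,3) by simp
next
  case (Suc k)
  define wk where "wk = w * (2 + \<eta>) ^ k"
  have wk: "0 < wk" using assms by (simp add: wk_def)
  have wS: "w * (2 + \<eta>) ^ Suc k = 2 * wk + \<eta> * wk" by (simp add: wk_def algebra_simps)
  define bad where "bad = {vs. length vs = k \<and> set vs \<subseteq> G \<and> \<not> good a B wk vs}"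
  define ok where "ok = {vs. length vs = k \<and> set vs \<subseteq> G \<and> good a B wk vs}"
  \<comment> \<open>Heads to avoid: those that depend on the tail and those with a large
    correlation.\<close>
  define ex where "ex vs = gspan vs \<union> {b \<in> G. corr a B (gspan vs) b > \<eta> * wk}" for vs
  have fin: "finite bad" "finite ok"
    using finite_lists_in [of k] by (auto simp: bad_def ok_def elim: rev_finite_subset)
  have finex: "finite (ex vs)" if "vs \<in> ok" for vs
    using that finite_carrier subgp_finite subgp_gspan by (auto simp: ex_def ok_def)
  have cex: "card (ex vs) \<le> 2 ^ k + wk / \<eta>" if "vs \<in> ok" for vs
  proof -
    have "card (ex vs) \<le> card (gspan vs) + card {b \<in> G. corr a B (gspan vs) b > \<eta> * wk}"
      unfolding ex_def by (rule card_Un_le)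
    moreover have "card (gspan vs) = 2 ^ k" "potential a B (gspan vs) \<le> wk"
      using that by (auto simp: ok_def good_def)
    ultimately show ?thesis
      using card_large_corr [OF assms(1) _ wk assms(2), of B "gspan vs"]
      by (simp add: of_nat_le_iff [symmetric, where 'a = real] del: of_nat_le_iff)
  qed
  have "{vs. length vs = Suc k \<and> set vs \<subseteq> G \<and> \<not> good a B (w * (2 + \<eta>) ^ Suc k) vs}
      \<subseteq> (\<lambda>(vs, v). v # vs) ` (bad \<times> G \<union> Sigma ok ex)" (is "?L \<subseteq> _")
  proof
    fix ws assume ws: "ws \<in> ?L"
    then obtain v vs where wv: "ws = v # vs" by (cases ws) auto
    have *: "length vs = k" "v \<in> G" "set vs \<subseteq> G" "\<not> good a B (2 * wk + \<eta> * wk) (v # vs)"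
      using ws unfolding wv wS by auto
    have "(vs, v) \<in> bad \<times> G \<union> Sigma ok ex"
    proof (rule ccontr)
      assume "(vs, v) \<notin> bad \<times> G \<union> Sigma ok ex"
      then have g: "good a B wk vs" and v: "v \<notin> gspan vs" "corr a B (gspan vs) v \<le> \<eta> * wk"
        using * by (auto simp: bad_def ok_def ex_def not_less)
      have "potential a B (gspan (v # vs)) \<le> 2 * wk + \<eta> * wk"
        using potential_extend [OF subgp_gspan [OF *(3)] *(2) assms(1), of B] g v(2)
        by (simp add: good_def)
      moreover have "card (gspan (v # vs)) = 2 ^ length (v # vs)"
        using card_gspan_Cons_notin [OF *(3,2) v(1)] g by (simp add: good_def)
      ultimately show False using *(4) by (simp add: good_def)
    qed
    then show "ws \<in> (\<lambda>(vs, v). v # vs) ` (bad \<times> G \<union> Sigma ok ex)" using wv by force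
  qed
  moreover have "finite (bad \<times> G \<union> Sigma ok ex)"
    using fin finex finite_carrier by auto
  ultimately have "card ?L \<le> card (bad \<times> G \<union> Sigma ok ex)"
    by (meson card_image_le card_mono finite_imageI order_trans)
  also have "\<dots> \<le> card (bad \<times> G) + card (Sigma ok ex)" by (rule card_Un_le)
  also have "\<dots> = card bad * card G + (\<Sum>vs\<in>ok. card (ex vs))"
    using fin finex by (simp add: card_cartesian_product)
  finally have "real (card ?L) \<le> real (card bad * card G + (\<Sum>vs\<in>ok. card (ex vs)))"
    by (rule of_nat_mono)
  also have "\<dots> = real (card bad * card G) + (\<Sum>vs\<in>ok. real (card (ex vs)))"
    by simp
  also have "(\<Sum>vs\<in>ok. real (card (ex vs))) \<le> card ok * (2 ^ k + wk / \<eta>)"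
    using sum_mono [of ok "\<lambda>vs. real (card (ex vs))" "\<lambda>_. 2 ^ k + wk / \<eta>"] cex by simp
  also have "real (card ok) \<le> real (card G) ^ k"
  proof -
    have "card ok \<le> card {vs. length vs = k \<and> set vs \<subseteq> G}"
      using finite_lists_in by (intro card_mono) (auto simp: ok_def)
    also have "\<dots> = card G ^ k"
      using card_lists_length_eq [OF finite_carrier, of k] by (simp add: conj_commute)
    finally show ?thesis by (metis of_nat_le_iff of_nat_power)
  qed
  finally have "real (card ?L) \<le> real (card bad * card G) + real (card G) ^ k * (2 ^ k + wk / \<eta>)"
    using assms(2) wk by (simp add: mult_right_mono)
  \<comment> \<open>Bad tails and exceptional heads contribute the same amount. The resulting factor
    2 is absorbed because the threshold at least doubles in each step.\<close>
  also have "\<dots> \<le> real (card G) ^ k * (wk / \<eta> + 2 ^ k) + real (card G) ^ k * (2 ^ k + wk / \<eta>)"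
    using Suc.IH by (simp add: bad_def wk_def mult.commute)
  also have "\<dots> = real (card G) ^ k * (2 * wk / \<eta> + 2 ^ Suc k)"
    by (simp add: algebra_simps)
  also have "\<dots> \<le> real (card G) ^ k * (w * (2 + \<eta>) ^ Suc k / \<eta> + 2 ^ Suc k)"
    unfolding wS using assms(2) wk by (intro mult_left_mono add_right_mono divide_right_mono) auto
  finally have "real (card G) * card ?L
      \<le> real (card G) * (real (card G) ^ k * (w * (2 + \<eta>) ^ Suc k / \<eta> + 2 ^ Suc k))"
    by (intro mult_left_mono) auto
  then show ?case by (simp add: mult.assoc)
qed

end

subsection \<open>Binary matrices and the size of rank balls\<close>

lemma UNIV_bit: "(UNIV :: bit set) = {0, 1}"
proof (rule UNIV_eq_I)
  show "x \<in> {0, 1}" for x :: bit by (cases x) simp_all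
qed

lemma finite_carrier_vec_bit: "finite (carrier_vec m :: bit vec set)"
  and card_carrier_vec_bit: "card (carrier_vec m :: bit vec set) = 2 ^ m"
proof -
  have bij: "bij_betw list_of_vec (carrier_vec m :: bit vec set) {xs. set xs \<subseteq> UNIV \<and> length xs = m}"
  proof (rule bij_betw_byWitness [where f' = vec_of_list])
    show "list_of_vec ` carrier_vec m \<subseteq> {xs :: bit list. set xs \<subseteq> UNIV \<and> length xs = m}"
      by auto
    show "vec_of_list ` {xs :: bit list. set xs \<subseteq> UNIV \<and> length xs = m} \<subseteq> carrier_vec m"
      by (auto intro: carrier_vecI)
  qed (simp_all add: vec_list list_vec)
  have fin: "finite (UNIV :: bit set)" "card (UNIV :: bit set) = 2"
    by (simp_all add: UNIV_bit)
  show "finite (carrier_vec m :: bit vec set)"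
    using bij_betw_finite [OF bij] finite_lists_length_eq [OF fin(1), of m] by simp
  show "card (carrier_vec m :: bit vec set) = 2 ^ m"
    using bij_betw_same_card [OF bij] card_lists_length_eq [OF fin(1), of m] fin(2) by simp
qed

lemma bij_betw_cols: "bij_betw cols (carrier_mat m n) {vs. set vs \<subseteq> carrier_vec m \<and> length vs = n}"
  by (rule bij_betw_byWitness [where f' = "mat_of_cols m"])
    (auto simp: carrier_matD dest: subsetD [OF cols_dim])

lemma finite_carrier_mat_bit: "finite (carrier_mat m n :: bit mat set)"
  using bij_betw_finite [OF bij_betw_cols]
    finite_lists_length_eq [OF finite_carrier_vec_bit] by blast

lemma card_carrier_mat_bit: "card (carrier_mat m n :: bit mat set) = 2 ^ (m * n)"
  using bij_betw_same_card [OF bij_betw_cols [where 'a = bit], of m n]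
    card_lists_length_eq [OF finite_carrier_vec_bit [of m], of n] card_carrier_vec_bit [of m]
  by (simp add: power_mult)

lemma add_self_bit [simp]: "(x :: bit) + x = 0"
  by (cases x) simp_all

interpretation vecs: elementary_two_group "carrier_vec m :: bit vec set" "(+)" "0\<^sub>v m" for m
  by unfold_locales (auto simp: finite_carrier_vec_bit comm_add_vec assoc_add_vec)

interpretation mats: elementary_two_group "carrier_mat m n :: bit mat set" "(+)" "0\<^sub>m m n" for m n
  by unfold_locales (auto simp: finite_carrier_mat_bit comm_add_mat assoc_add_mat)

text \<open>Split off the first coefficient: the value 0 leaves the span of the tail, the value 1
  gives its translate by \<open>Y\<close>.\<close>

lemma span2_eq_gspan: "set Ys \<subseteq> carrier_mat m n \<Longrightarrow> span2 m n Ys = mats.gspan m n Ys"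
proof (induction Ys)
  case Nil
  then show ?case by (simp add: span2_def)
next
  case (Cons Y Ys)
  let ?l = "\<lambda>cs. lsum m n (map2 (\<lambda>c A. c \<cdot>\<^sub>m A) cs Ys)"
  have Y: "Y \<in> carrier_mat m n" using Cons.prems by simp
  have IH: "span2 m n Ys = mats.gspan m n Ys" using Cons by simp
  then have in_carrier: "?l cs \<in> carrier_mat m n" if "length cs = length Ys" for cs
    using mats.subgp_gspan [of Ys m n] Cons.prems that by (auto simp: span2_def mats.subgp_def)
  have smult: "0 \<cdot>\<^sub>m Y + ?l cs = ?l cs" "1 \<cdot>\<^sub>m Y + ?l cs = Y + ?l cs" if "length cs = length Ys" for cs
    using Y in_carrier [OF that] by auto
  have "span2 m n (Y # Ys) = (\<lambda>(c, cs). c \<cdot>\<^sub>m Y + ?l cs) ` (UNIV \<times> {cs. length cs = length Ys})"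
    unfolding span2_def by (force simp: length_Suc_conv image_iff)
  also have "\<dots> = span2 m n Ys \<union> (+) Y ` span2 m n Ys"
    unfolding span2_def UNIV_bit using smult by (force simp: image_iff)
  finally show ?case using IH by simp
qed

section \<open>Column rank and the size of the column span\<close>

lemma (in vec_space) card_span_le:
  assumes "finite (UNIV :: 'a set)" "finite S" "S \<subseteq> carrier_vec n"
  shows "finite (span S)" "card (span S) \<le> card (UNIV :: 'a set) ^ card S"
proof -
  have "span S \<subseteq> (\<lambda>a. lincomb a S) ` (S \<rightarrow>\<^sub>E UNIV)"
  proof
    fix x assume "x \<in> span S"
    then obtain a where a: "x = lincomb a S"
      using finite_in_span [OF assms(2), of x] assms(3) by auto
    \<comment> \<open>Restricting the coefficients to \<open>S\<close> puts them into a finite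
      function space.\<close>
    then have "x = lincomb (restrict a S) S"
      using assms(3) by (auto intro!: lincomb_cong)
    then show "x \<in> (\<lambda>a. lincomb a S) ` (S \<rightarrow>\<^sub>E UNIV)" by (intro image_eqI) auto
  qed
  moreover have fin: "finite (S \<rightarrow>\<^sub>E (UNIV :: 'a set))"
    using assms by (intro finite_PiE) auto
  ultimately show "finite (span S)" by (rule finite_subset [OF _ finite_imageI])
  have "card (span S) \<le> card ((\<lambda>a. lincomb a S) ` (S \<rightarrow>\<^sub>E (UNIV :: 'a set)))"
    using fin \<open>span S \<subseteq> _\<close> by (intro card_mono) auto
  also have "\<dots> \<le> card (S \<rightarrow>\<^sub>E (UNIV :: 'a set))" using fin by (rule card_image_le)
  also have "\<dots> = card (UNIV :: 'a set) ^ card S" using assms(2) by (simp add: card_PiE)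
  finally show "card (span S) \<le> card (UNIV :: 'a set) ^ card S" .
qed

text \<open>A maximal independent set of columns has \<open>rank A\<close> elements, and a column
  outside its span could be added to it.\<close>

lemma (in vec_space) rank_spanning_set:
  assumes A: "A \<in> carrier_mat n nc"
  obtains S where "finite S" "S \<subseteq> carrier_vec n" "card S = rank A" "set (cols A) \<subseteq> span S"
proof -
  define W where "W = set (cols A)"
  have W: "W \<subseteq> carrier_vec n" "finite W" using cols_dim [of A] A by (auto simp: W_def)
  have "lin_indpt {}" unfolding lin_dep_def by blast
  then obtain S where S: "maximal S (\<lambda>T. T \<subseteq> W \<and> lin_indpt T)" "finite S"
    using maximal_exists_superset [OF W(2), of "\<lambda>T. T \<subseteq> W \<and> lin_indpt T" "{}"] by blast
  then have SW: "S \<subseteq> W" "lin_indpt S" by (auto simp: maximal_def)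
  then have Sc: "S \<subseteq> carrier_vec n" using W by blast
  have rank: "card S = rank A"
    using rank_card_indpt [OF A] S(1) W_def by simp
  have "W \<subseteq> span S"
  proof
    fix s assume s: "s \<in> W"
    show "s \<in> span S"
    proof (rule ccontr)
      assume ns: "s \<notin> span S"
      then have "s \<notin> S" using span_mem Sc by auto
      moreover have "lin_indpt (S \<union> {s})"
        using lin_dep_iff_in_span [of S s] ns Sc SW(2) s W \<open>s \<notin> S\<close> by auto
      moreover have "S \<union> {s} \<subseteq> W" using s SW(1) by blast
      ultimately show False
        using S(1) unfolding maximal_def by blast
    qed
  qed
  then show thesis using that S(2) Sc rank W_def by blast
qed

text \<open>Phrased by plain closure conditions on \<open>W\<close>, so that outside the locale an
  induction on lists can place \<open>gspan\<close> inside \<open>W\<close>.\<close>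

lemma (in vec_space) rank_span_cover:
  assumes A: "A \<in> carrier_mat n nc" and "finite (UNIV :: 'a set)"
  shows "\<exists>W. finite W \<and> card W \<le> card (UNIV :: 'a set) ^ rank A \<and> set (cols A) \<subseteq> W
           \<and> 0\<^sub>v n \<in> W \<and> (\<forall>x\<in>W. \<forall>y\<in>W. x + y \<in> W)"
proof -
  obtain S where S: "finite S" "S \<subseteq> carrier_vec n" "card S = rank A" "set (cols A) \<subseteq> span S"
    using rank_spanning_set [OF A] .
  have "0\<^sub>v n \<in> span S" using vectorspace.span_zero [OF vectorspace_axioms, of S] by simp
  moreover have "x + y \<in> span S" if "x \<in> span S" "y \<in> span S" for x y
    using span_add1 [of S x y] S(2) that by simp
  ultimately show ?thesis
    using S card_span_le [OF assms(2) S(1,2)] by (intro exI [of _ "span S"]) auto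
qed

lemma card_gspan_cols_le:
  assumes "A \<in> carrier_mat m n"
  shows "card (vecs.gspan m (cols A)) \<le> 2 ^ rank2 m A"
proof -
  have bits: "finite (UNIV :: bit set)" "card (UNIV :: bit set) = 2"
    by (simp_all add: UNIV_bit)
  obtain W where W: "finite W" "card W \<le> 2 ^ rank2 m A" "set (cols A) \<subseteq> W" "0\<^sub>v m \<in> W"
    "\<forall>x\<in>W. \<forall>y\<in>W. x + y \<in> W"
    using vec_space.rank_span_cover [OF assms bits(1)] unfolding bits(2) rank2_def by blast
  have "set vs \<subseteq> W \<Longrightarrow> vecs.gspan m vs \<subseteq> W" for vs
    by (induction vs) (use W(4,5) in auto)
  then have "card (vecs.gspan m (cols A)) \<le> card W"
    using W(1,3) by (intro card_mono) auto
  with W(2) show ?thesis by linarith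
qed

text \<open>Matrices are sorted by the size \<open>2 ^ j\<close> of their column span. Of the slack
  \<open>2 * n\<close>, one \<open>n\<close> is the factor \<open>2 ^ n\<close> of
  \<open>card_rank_lists\<close>, the other pays for the sum over at most \<open>2 ^ n\<close>
  values of \<open>j\<close>. Both are negligible against \<open>m * n\<close>.\<close>

lemma card_rank_ball_le:
  fixes \<rho> :: real
  assumes "0 \<le> \<rho>" "\<rho> \<le> n" "n \<le> m"
  shows "card {Z \<in> carrier_mat m n. real (rank2 m Z) \<le> \<rho>} \<le> 2 powr (2 * n + \<rho> * (m + n - \<rho>))"
    (is "real (card ?B) \<le> _")
proof -
  define r where "r = nat \<lfloor>\<rho>\<rfloor>"
  have r: "k \<le> r \<longleftrightarrow> real k \<le> \<rho>" for k
    using assms(1) by (simp add: r_def le_nat_iff le_floor_iff)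
  have rn: "r \<le> n" using r [of r] assms(2) by simp
  have "cols ` ?B \<subseteq> (\<Union>j\<in>{..r}. vecs.rank_lists m n j)"
  proof
    fix vs assume "vs \<in> cols ` ?B"
    then obtain Z where Z: "Z \<in> carrier_mat m n" "real (rank2 m Z) \<le> \<rho>" "vs = cols Z" by auto
    then have vs: "set vs \<subseteq> carrier_vec m" "length vs = n" using cols_dim [of Z] by auto
    obtain j where j: "card (vecs.gspan m vs) = 2 ^ j" using vecs.card_gspan_power vs(1) by blast
    then have "(2::nat) ^ j \<le> 2 ^ rank2 m Z" using card_gspan_cols_le [OF Z(1)] Z(3) by simp
    then have "j \<le> rank2 m Z" by simp
    then have "j \<le> r" using r Z(2) by (meson le_trans)
    then show "vs \<in> (\<Union>j\<in>{..r}. vecs.rank_lists m n j)"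
      using vs j by (auto simp: vecs.rank_lists_def)
  qed
  moreover have "inj_on cols ?B"
    using bij_betw_cols [of m n] by (auto simp: bij_betw_def inj_on_def)
  ultimately have "card ?B \<le> card (\<Union>j\<in>{..r}. vecs.rank_lists m n j)"
    using vecs.finite_rank_lists by (metis (no_types, lifting) card_image card_mono finite_UN finite_atMost)
  also have "\<dots> \<le> (\<Sum>j\<le>r. card (vecs.rank_lists m n j))"
    by (rule card_UN_le) simp
  finally have "real (card ?B) \<le> (\<Sum>j\<le>r. real (card (vecs.rank_lists m n j)))"
    by (metis of_nat_mono of_nat_sum)
  also have "\<dots> \<le> (\<Sum>j\<le>r. 2 powr (n + \<rho> * (m + n - \<rho>)))"
  proof (rule sum_mono)
    fix j assume "j \<in> {..r}"
    then have j: "real j \<le> \<rho>" "j \<le> n" using r rn le_trans [of j r n] by auto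
    \<comment> \<open>The product is the difference of the two sides of the next inequality. Its
      second factor is nonnegative because \<open>j\<close> and \<open>\<rho>\<close> are at most
      \<open>n\<close> and \<open>n \<le> m\<close>.\<close>
    have "0 \<le> (\<rho> - j) * (m + n - \<rho> - j)"
      using j assms by (intro mult_nonneg_nonneg) linarith+
    then have "real j * (real m + real n - real j) \<le> \<rho> * (m + n - \<rho>)"
      by (simp add: algebra_simps)
    then have *: "real (j * (m + n - j)) \<le> \<rho> * (m + n - \<rho>)"
      using j(2) by (simp add: of_nat_diff)
    have "real (card (vecs.rank_lists m n j)) \<le> real (2 ^ n * 2 ^ (j * (m + n - j)))"
      using vecs.card_rank_lists [OF card_carrier_vec_bit j(2)] by (rule of_nat_mono)
    also have "\<dots> = 2 ^ n * 2 ^ (j * (m + n - j))"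
      by (simp only: of_nat_mult of_nat_power of_nat_numeral)
    also have "\<dots> = 2 powr (real n + real (j * (m + n - j)))"
      by (simp add: powr_realpow powr_add del: of_nat_mult)
    also have "\<dots> \<le> 2 powr (n + \<rho> * (m + n - \<rho>))"
      using * by (intro powr_mono) auto
    finally show "real (card (vecs.rank_lists m n j)) \<le> 2 powr (n + \<rho> * (m + n - \<rho>))" .
  qed
  also have "\<dots> = real (Suc r) * 2 powr (n + \<rho> * (m + n - \<rho>))" by simp
  also have "\<dots> \<le> 2 powr n * 2 powr (n + \<rho> * (m + n - \<rho>))"
  proof (rule mult_right_mono)
    have "Suc r \<le> 2 ^ n" using rn less_exp [of n] by linarith
    then have "real (Suc r) \<le> real (2 ^ n)" by (rule of_nat_mono)
    then show "real (Suc r) \<le> 2 powr n" by (simp add: powr_realpow)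
  qed simp
  also have "\<dots> = 2 powr (2 * n + \<rho> * (m + n - \<rho>))" by (simp flip: powr_add)
  finally show ?thesis by simp
qed

lemma minus_eq_plus_bit_mat:
  fixes X Y :: "bit mat"
  shows "X - Y = X + Y"
  by (rule eq_matI) auto

lemma list_decodable_iff_hits:
  fixes L :: real
  assumes "C \<subseteq> carrier_mat m n"
  shows "list_decodable m n C p L \<longleftrightarrow>
    (\<forall>X\<in>carrier_mat m n. mats.hits {Z \<in> carrier_mat m n. real (rank2 m Z) \<le> p * n} C X \<le> L)"
proof -
  have "rank_ball m n X (p * n) \<inter> C = {Y \<in> C. X + Y \<in> {Z \<in> carrier_mat m n. real (rank2 m Z) \<le> p * n}}"
    if "X \<in> carrier_mat m n" for X
    using that assms by (auto simp: rank_ball_def minus_eq_plus_bit_mat)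
  then show ?thesis by (simp add: list_decodable_def mats.hits_def)
qed

subsection \<open>List decodability\<close>

text \<open>The value of \<open>\<delta>\<close> is chosen so that \<open>(h + \<epsilon>) / (\<epsilon> - \<delta>) \<le> h / \<epsilon> + 2\<close> whenever \<open>h \<le> 1\<close>.\<close>

lemma good_list_decodable:
  fixes p \<epsilon> h \<delta> a w :: real and m n k :: nat
  defines "M \<equiv> real m * real n" and "B \<equiv> {Z \<in> carrier_mat m n. real (rank2 m Z) \<le> p * n}"
  assumes h: "0 \<le> h" "h \<le> 1" and \<epsilon>: "0 < \<epsilon>" and \<delta>: "\<delta> = \<epsilon>\<^sup>2 / (1 + 2 * \<epsilon>)"
    and k: "real k = (1 - h - \<epsilon>) * M" and M: "2 / \<delta> \<le> M"
    and a: "a = 2 powr ((\<epsilon> - \<delta>) * M)" and w: "w \<le> 2 powr ((1 - \<delta> / 2) * M)"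
    and Ys: "set Ys \<subseteq> carrier_mat m n" "length Ys = k" and good: "mats.good m n a B w Ys"
  shows "list_decodable m n (span2 m n Ys) p (h / \<epsilon> + 2)"
proof -
  have \<delta>0: "0 < \<delta>" "\<delta> < \<epsilon>"
    using \<epsilon> by (simp_all add: \<delta> field_simps power2_eq_square add_pos_pos)
  then have M0: "0 < M" using M by (smt (verit) divide_pos_pos)
  have a1: "1 \<le> a" using \<delta>0 M0 by (simp add: a ge_one_powr_ge_zero)
  let ?C = "mats.gspan m n Ys"
  have C: "mats.subgp m n ?C" using mats.subgp_gspan [OF Ys(1)] .
  have "real (mats.hits B ?C X) \<le> h / \<epsilon> + 2" if X: "X \<in> carrier_mat m n" for X
  proof -
    define l where "l = mats.hits B ?C X"
    \<comment> \<open>Independence, part of \<open>good\<close>, gives the coset of \<open>X\<close>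
      exactly \<open>2 ^ k\<close> elements.\<close>
    have "2 ^ k * (a ^ l - 1) \<le> w"
      using mats.card_mult_hits_le_potential [OF C X a1, of B] good Ys(2)
      by (simp add: mats.good_def l_def)
    also have "\<dots> \<le> 2 ^ k * 2 powr ((1 - \<delta> / 2) * M - k)"
      using w by (simp add: powr_diff powr_realpow)
    finally have "a ^ l \<le> 1 + 2 powr ((1 - \<delta> / 2) * M - k)"
      by simp
    also have "(1 - \<delta> / 2) * M - k = (h + \<epsilon>) * M - \<delta> / 2 * M"
      by (simp add: k algebra_simps)
    \<comment> \<open>The 1 is absorbed by doubling a power that is at least 1;
      \<open>2 / \<delta> \<le> M\<close> frees a full unit of the exponent for this.\<close>
    also have "1 + 2 powr \<dots> \<le> 2 powr ((h + \<epsilon>) * M)"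
    proof -
      have "0 \<le> (h + \<epsilon> - \<delta> / 2) * M" using h \<delta>0 M0 by simp
      then have "1 \<le> 2 powr ((h + \<epsilon>) * M - \<delta> / 2 * M)"
        by (intro ge_one_powr_ge_zero) (simp_all add: algebra_simps)
      then have "1 + 2 powr ((h + \<epsilon>) * M - \<delta> / 2 * M) \<le> 2 powr (1 + ((h + \<epsilon>) * M - \<delta> / 2 * M))"
        by (simp add: powr_add)
      also have "\<dots> \<le> 2 powr ((h + \<epsilon>) * M)"
        using M \<delta>0 by (intro powr_mono) (simp_all add: field_simps)
      finally show ?thesis .
    qed
    also have "a ^ l = 2 powr (l * ((\<epsilon> - \<delta>) * M))"
      by (simp add: a powr_powr flip: powr_realpow) (simp add: mult.commute)
    finally have "l * ((\<epsilon> - \<delta>) * M) \<le> (h + \<epsilon>) * M" by simp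
    then have "l * (\<epsilon> - \<delta>) \<le> h + \<epsilon>" using M0 by simp
    also have "\<dots> \<le> (h / \<epsilon> + 2) * (\<epsilon> - \<delta>)"
    proof -
      \<comment> \<open>The product \<open>(h + 2 * \<epsilon>) * (\<epsilon> - \<delta>)\<close>
        exceeds \<open>\<epsilon> * (h + \<epsilon>)\<close> by
        \<open>\<epsilon>\<^sup>2 - \<delta> * (h + 2 * \<epsilon>)\<close>, which the choice of
        \<delta> keeps nonnegative.\<close>
      have "\<delta> * (h + 2 * \<epsilon>) \<le> \<delta> * (1 + 2 * \<epsilon>)" using h \<delta>0 by simp
      also have "\<dots> = \<epsilon>\<^sup>2" using \<epsilon> by (simp add: \<delta>)
      finally have "\<epsilon> * (h + \<epsilon>) \<le> (h + 2 * \<epsilon>) * (\<epsilon> - \<delta>)"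
        by (simp add: algebra_simps power2_eq_square)
      then show ?thesis using \<epsilon> by (simp add: field_simps)
    qed
    finally show ?thesis using \<delta>0 by (simp add: l_def)
  qed
  then show ?thesis
    using C by (simp add: span2_eq_gspan [OF Ys(1)] list_decodable_iff_hits mats.subgp_def B_def)
qed

text \<open>The slack \<delta> in the exponent is spent in four portions \<theta>: on the term
  \<open>2 * n\<close> of the ball size, on the growth factor
  \<open>2 + \<eta> = 2 powr (1 + \<theta>)\<close>, on the constant \<open>1 / \<eta> + 1\<close>,
  and on the failure probability that remains.\<close>

lemma prob_rand_code_ld_ge:
  fixes p \<beta> \<epsilon> h \<delta> \<theta> \<eta> :: real and m n k :: nat
  defines "M \<equiv> real m * real n"
  assumes p: "0 < p" "p < 1" and nm: "0 < n" "n < m" and \<epsilon>: "0 < \<epsilon>"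
    and \<beta>: "\<beta> = n / m" and h_def: "h = p + \<beta> * p - \<beta> * p\<^sup>2"
    and \<delta>: "\<delta> = \<epsilon>\<^sup>2 / (1 + 2 * \<epsilon>)" and \<theta>: "\<theta> = \<delta> / 4" and \<eta>: "\<eta> = 2 * (2 powr \<theta> - 1)"
    and k: "real k = (1 - h - \<epsilon>) * M" and m: "2 / \<theta> \<le> m"
    and M: "1 / \<eta> + 1 \<le> 2 powr (\<theta> * M)"
  shows "prob_rand_code_ld m n k p (h / \<epsilon> + 2) \<ge> 1 - 2 powr (- \<theta> * M)"
proof -
  have \<delta>0: "0 < \<delta>" "\<delta> < \<epsilon>"
    using \<epsilon> by (simp_all add: \<delta> field_simps power2_eq_square add_pos_pos)
  have \<theta>0: "0 < \<theta>" using \<delta>0 by (simp add: \<theta>)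
  have \<eta>0: "0 < \<eta>" using \<theta>0 by (simp add: \<eta>)
  have M0: "0 < M" "m \<le> M" using nm by (simp_all add: M_def)
  have b: "0 \<le> \<beta>" "\<beta> \<le> 1" "\<beta> * m = n" using nm by (auto simp: \<beta>)
  have h0: "0 \<le> h"
  proof -
    have "h = p + \<beta> * (p * (1 - p))" by (simp add: h_def algebra_simps power2_eq_square)
    then show ?thesis using p b by simp
  qed
  have h1: "h \<le> 1"
  proof -
    have "\<beta> * p \<le> 1 * 1" using b p by (intro mult_mono) auto
    \<comment> \<open>This product equals \<open>1 - h\<close>, the rate before \<epsilon> is
      subtracted.\<close>
    then have "0 \<le> (1 - p) * (1 - \<beta> * p)" using p by simp
    then show ?thesis by (simp add: h_def algebra_simps power2_eq_square)
  qed
  \<comment> \<open>At radius \<open>p * n\<close> the exponent of the ball size is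
    \<open>h * M\<close>, because \<open>n\<close> is \<open>\<beta> * m\<close>.\<close>
  have hM: "p * real n * (real m + real n - p * real n) = h * M"
  proof -
    have "h * M = p * n * m + p * n * (\<beta> * m) - p * p * n * (\<beta> * m)"
      by (simp add: h_def M_def algebra_simps power2_eq_square)
    then show ?thesis by (simp add: b(3) algebra_simps)
  qed
  have kM: "k \<le> M"
  proof -
    have "(1 - h - \<epsilon>) * M \<le> 1 * M" using h0 \<epsilon> M0 by (intro mult_right_mono) auto
    then show ?thesis using k by simp
  qed
  have n\<theta>: "2 * real n \<le> \<theta> * M"
  proof -
    have "2 \<le> \<theta> * m" using m \<theta>0 by (simp add: field_simps)
    then have "2 * real n \<le> (\<theta> * m) * real n" by (intro mult_right_mono) auto
    then show ?thesis by (simp add: M_def algebra_simps)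
  qed
  define a where "a = 2 powr ((\<epsilon> - \<delta>) * M)"
  define B where "B = {Z \<in> carrier_mat m n. real (rank2 m Z) \<le> p * n}"
  define w where "w = a * 2 powr (2 * real n + h * M)"
  define w' where "w' = w * (2 + \<eta>) ^ k"
  have a1: "1 \<le> a" using \<delta>0 M0 by (simp add: a_def ge_one_powr_ge_zero)
  have w0: "0 < w" using a1 by (simp add: w_def)
  have cardB: "(a - 1) * card B \<le> w"
  proof -
    have "p * n \<le> n" using p mult_right_mono [of p 1 "real n"] by simp
    then have "card B \<le> 2 powr (2 * real n + h * M)"
      using card_rank_ball_le [of "p * n" n m] p nm by (simp add: B_def hM)
    then show ?thesis unfolding w_def using a1 by (intro mult_mono) auto
  qed
  have w': "w' \<le> 2 powr ((1 - \<delta> / 2) * M)"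
  proof -
    have "2 + \<eta> = 2 powr (1 + \<theta>)" by (simp add: \<eta> powr_add)
    then have "(2 + \<eta>) ^ k = 2 powr ((1 + \<theta>) * k)" by (simp add: powr_powr flip: powr_realpow)
    then have "w' = 2 powr ((\<epsilon> - \<delta>) * M + (2 * real n + h * M) + (1 + \<theta>) * k)"
      by (simp add: w'_def w_def a_def powr_add)
    also have "\<dots> \<le> 2 powr ((1 - \<delta> / 2) * M)"
    proof (rule powr_mono)
      have "\<theta> * k \<le> \<theta> * M" using kM \<theta>0 by simp
      then have "(\<epsilon> - \<delta>) * M + (2 * real n + h * M) + (1 + \<theta>) * k
          \<le> (\<epsilon> - \<delta>) * M + (\<theta> * M + h * M) + (1 - h - \<epsilon>) * M + \<theta> * M"
        using n\<theta> by (simp add: k [symmetric] distrib_right mult.commute [of M])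
      also have "\<dots> = (1 - \<delta> / 2) * M" by (simp add: \<theta> algebra_simps)
      finally show "(\<epsilon> - \<delta>) * M + (2 * real n + h * M) + (1 + \<theta>) * k \<le> (1 - \<delta> / 2) * M" .
    qed simp
    finally show ?thesis .
  qed
  define G where "G = (carrier_mat m n :: bit mat set)"
  define tot where "tot = {Ys. length Ys = k \<and> set Ys \<subseteq> G}"
  define ld where "ld = {Ys. length Ys = k \<and> set Ys \<subseteq> G \<and> list_decodable m n (span2 m n Ys) p (h / \<epsilon> + 2)}"
  define bad where "bad = {Ys. length Ys = k \<and> set Ys \<subseteq> G \<and> \<not> mats.good m n a B w' Ys}"
  have cG: "real (card G) = 2 powr M"
  proof -
    have "real (card G) = 2 ^ (m * n)" by (simp add: G_def card_carrier_mat_bit)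
    then show ?thesis by (simp add: M_def powr_realpow flip: of_nat_mult)
  qed
  have fin: "finite tot" unfolding tot_def G_def by (rule mats.finite_lists_in)
  have ctot: "card tot = card G ^ k"
    using card_lists_length_eq [OF finite_carrier_mat_bit [of m n], of k]
    by (simp add: tot_def G_def conj_commute)
  have tot0: "0 < real (card tot)" unfolding ctot using cG by simp
  have "tot \<subseteq> ld \<union> bad"
  proof
    fix Ys assume Y: "Ys \<in> tot"
    show "Ys \<in> ld \<union> bad"
    proof (cases "mats.good m n a B w' Ys")
      case True
      have "2 / \<delta> \<le> 2 / \<theta>" using \<delta>0 by (simp add: \<theta> field_simps)
      then have "2 / \<delta> \<le> real m * real n" using m M0 by (simp add: M_def)
      then have "list_decodable m n (span2 m n Ys) p (h / \<epsilon> + 2)"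
        using good_list_decodable [OF h0 h1 \<epsilon> \<delta> k [unfolded M_def] _ a_def [unfolded M_def] w' [unfolded M_def]]
          Y True by (simp add: tot_def G_def B_def)
      then show ?thesis using Y by (simp add: ld_def tot_def)
    qed (use Y in \<open>simp add: bad_def tot_def\<close>)
  qed
  then have "card tot \<le> card ld + card bad"
    using fin by (intro order_trans [OF card_mono card_Un_le])
      (auto simp: tot_def ld_def bad_def elim: rev_finite_subset)
  then have "real (card tot) \<le> real (card ld) + real (card bad)" by (metis of_nat_add of_nat_mono)
  then have "real (card tot) / card tot \<le> (real (card ld) + real (card bad)) / card tot"
    by (rule divide_right_mono) simp
  then have "1 - card bad / card tot \<le> card ld / card tot"
    using tot0 by (simp add: add_divide_distrib)
  moreover have "card bad / card tot \<le> 2 powr (- \<theta> * M)"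
  proof -
    have "2 powr M * card bad \<le> card tot * (w' / \<eta> + 2 ^ k)"
      using mats.card_not_good [OF a1 \<eta>0 w0 cardB, of m n k]
      by (simp add: B_def bad_def w'_def ctot G_def flip: cG)
    then have "card bad / card tot \<le> (w' / \<eta> + 2 ^ k) / 2 powr M"
      using tot0 by (simp add: field_simps)
    also have "\<dots> \<le> (2 powr ((1 - \<delta> / 2) * M) / \<eta> + 2 powr ((1 - \<delta> / 2) * M)) / 2 powr M"
    proof (intro divide_right_mono add_mono)
      have "(1 - h - \<epsilon>) * M \<le> (1 - \<delta> / 2) * M"
        using h0 \<delta>0 M0 by (intro mult_right_mono) auto
      then have "2 powr real k \<le> 2 powr ((1 - \<delta> / 2) * M)" by (simp add: k)
      then show "2 ^ k \<le> 2 powr ((1 - \<delta> / 2) * M)" by (simp add: powr_realpow)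
    qed (use w' \<eta>0 in auto)
    also have "\<dots> = (1 / \<eta> + 1) * 2 powr ((1 - \<delta> / 2) * M - M)"
      by (subst powr_diff) (simp add: add_divide_distrib distrib_right mult.commute)
    also have "\<dots> \<le> 2 powr (\<theta> * M) * 2 powr ((1 - \<delta> / 2) * M - M)"
      using M by (intro mult_right_mono) auto
    also have "\<dots> = 2 powr (- \<theta> * M)"
      by (simp add: \<theta> algebra_simps flip: powr_add)
    finally show ?thesis .
  qed
  ultimately show ?thesis
    by (simp add: prob_rand_code_ld_def tot_def ld_def G_def)
qed

section \<open>Choice of the constants\<close>

theorem theorem6:
  fixes p \<epsilon> :: real
  assumes "0 < p" and "p < 1" and "0 < \<epsilon>"
  shows "\<exists>C > 0. \<exists>N::nat. \<forall>m n k :: nat.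
           N \<le> n \<and> n < m \<and>
           real k = ((1 - p) * (1 - (real n / real m) * p) - \<epsilon>) * real m * real n \<longrightarrow>
           prob_rand_code_ld m n k p
             ((p + (real n / real m) * p - (real n / real m) * p\<^sup>2) / \<epsilon> + 2)
           \<ge> 1 - exp (- C * real m * real n)"
proof -
  define \<delta> where "\<delta> = \<epsilon>\<^sup>2 / (1 + 2 * \<epsilon>)"
  define \<theta> where "\<theta> = \<delta> / 4"
  define \<eta> where "\<eta> = 2 * (2 powr \<theta> - 1)"
  have \<theta>0: "0 < \<theta>" using assms by (simp add: \<theta>_def \<delta>_def add_pos_pos)
  have \<eta>0: "0 < \<eta>" using \<theta>0 by (simp add: \<eta>_def)
  \<comment> \<open>For \<open>N \<le> n\<close> and \<open>n < m\<close>, the first summand yields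
    \<open>2 / \<theta> \<le> m\<close>, the second makes \<open>2 powr (\<theta> * (m * n))\<close>
    at least \<open>1 / \<eta> + 1\<close>, and the last keeps \<open>n\<close> positive.\<close>
  define N where "N = nat \<lceil>2 / \<theta> + log 2 (1 / \<eta> + 1) / \<theta> + 1\<rceil>"
  have log0: "0 \<le> log 2 (1 / \<eta> + 1)"
    using \<eta>0 by (subst zero_le_log_cancel_iff) (simp_all add: add_pos_pos)
  have N: "2 / \<theta> + log 2 (1 / \<eta> + 1) / \<theta> + 1 \<le> N"
    unfolding N_def by (rule real_nat_ceiling_ge)
  have parts: "0 \<le> 2 / \<theta>" "0 \<le> log 2 (1 / \<eta> + 1) / \<theta>"
    using \<theta>0 log0 by simp_all
  show ?thesis
  \<comment> \<open>The factor \<open>ln 2\<close> converts powers of 2 to \<open>exp\<close>. Both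
    witnesses depend on \<epsilon> alone.\<close>
  proof (intro exI [of _ "\<theta> * ln 2"] conjI exI [of _ N] allI impI)
    show "0 < \<theta> * ln 2" using \<theta>0 by simp
    fix m n k :: nat
    assume asm: "N \<le> n \<and> n < m \<and>
      real k = ((1 - p) * (1 - (real n / real m) * p) - \<epsilon>) * real m * real n"
    define \<beta> where "\<beta> = real n / real m"
    define h where "h = p + \<beta> * p - \<beta> * p\<^sup>2"
    have k: "real k = (1 - h - \<epsilon>) * (real m * real n)"
      using asm by (simp add: h_def algebra_simps power2_eq_square flip: \<beta>_def)
    have n: "real N \<le> n" "n < m" using asm by auto
    then have n0: "0 < n" using N parts by linarith
    have m: "2 / \<theta> \<le> m" using N parts n by linarith
    have "1 / \<eta> + 1 \<le> 2 powr (\<theta> * (real m * real n))"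
    proof -
      have "log 2 (1 / \<eta> + 1) / \<theta> \<le> n" using N parts n by linarith
      also have "\<dots> \<le> real m * real n" using n(2) mult_right_mono [of 1 "real m" "real n"] by simp
      finally have "log 2 (1 / \<eta> + 1) \<le> \<theta> * (real m * real n)"
        using \<theta>0 by (simp add: field_simps)
      then show ?thesis using \<eta>0 by (simp add: log_le_iff add_pos_pos)
    qed
    then have "prob_rand_code_ld m n k p (h / \<epsilon> + 2) \<ge> 1 - 2 powr (- \<theta> * (real m * real n))"
      using prob_rand_code_ld_ge [OF assms(1,2) n0 n(2) assms(3) \<beta>_def h_def \<delta>_def \<theta>_def \<eta>_def k m] by simp
    moreover have "2 powr (- \<theta> * (real m * real n)) = exp (- (\<theta> * ln 2) * real m * real n)"
      by (simp add: powr_def algebra_simps)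
    ultimately show "prob_rand_code_ld m n k p
             ((p + (real n / real m) * p - (real n / real m) * p\<^sup>2) / \<epsilon> + 2)
           \<ge> 1 - exp (- (\<theta> * ln 2) * real m * real n)"
      by (simp add: h_def \<beta>_def)
  qed
qed

end
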